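(* If two modular, l.f.f.c. lattices are isomorphic, then their dissections are isomorphic as modular connected systems.
   Context: A lattice is l.f.f.c. if every closed interval is finite and every element has finitely many upper and lower covers. For $x$ in a modular l.f.f.c. lattice $L$, $x^*=x$ if $x$ is the top of $L$, otherwise the join of all upper covers of $x$; dually $x_*$. A block of $L$ is a maximal (under inclusion) complemented interval $B=[0_B,1_B]$ of $L$. The skeleton $S$ is the set of blocks ordered by $B\le C$ iff $0_B\le 0_C$; it is a lattice. The dissection of $L$ is the modular connected system consisting of skeleton $S$, tolerance $\gamma$ with $B\,\gamma\,C$ iff $B\cap C\ne\emptyset$, blocks $L_B=B$ (ordered as in $L$) for $B\in S$, and, for $B\le C$ with $B\cap C\neq\emptyset$, the connection $\varphi_B^C$ equal to the identity map from $F_B^C=B\cap C$ onto $I_B^C=B\cap C$. For systems $\mathcal C=(S,\gamma,(L_x)_{x\in S},(\varphi_x^y:F_x^y\to I_x^y)_{x\le_\gamma y})$ and $\mathcal C'=(S',\gamma',(L'_x),(\varphi'^y_x:F'^y_x\to I'^y_x))$ (where $x\le_\gamma y$ means $x\le y$ and $x\,\gamma\,y$), an isomorphism is a lattice isomorphism $\chi_S:S\to S'$ with lattice isomorphisms $\chi_x:L_x\to L'_{\chi_S(x)}$ such that $x\,\gamma\,y\iff\chi_S(x)\,\gamma'\,\chi_S(y)$ and, for $x\le_\gamma y$, $F'^{\chi_S(y)}_{\chi_S(x)}=\chi_x(F_x^y)$, $I'^{\chi_S(y)}_{\chi_S(x)}=\chi_y(I_x^y)$, and $\chi_y(\varphi_x^y(a))=\varphi'^{\chi_S(y)}_{\chi_S(x)}(\chi_x(a))$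 for all $a\in F_x^y$. *)

theory Defs
  imports "HOL-Algebra.Lattice"
begin

section \<open>Modular l.f.f.c. lattices\<close>

definition covers :: "('a, 'm) gorder_scheme \<Rightarrow> 'a \<Rightarrow> 'a \<Rightarrow> bool"
  where "covers L x y \<longleftrightarrow> x \<in> carrier L \<and> y \<in> carrier L \<and> x \<sqsubset>\<^bsub>L\<^esub> y
    \<and> \<not> (\<exists>z\<in>carrier L. x \<sqsubset>\<^bsub>L\<^esub> z \<and> z \<sqsubset>\<^bsub>L\<^esub> y)"

locale modular_lattice = lattice +
  assumes modular: "\<lbrakk>x \<in> carrier L; y \<in> carrier L; z \<in> carrier L; x \<sqsubseteq> z\<rbrakk>
    \<Longrightarrow> x \<squnion> (y \<sqinter> z) = (x \<squnion> y) \<sqinter> z"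

text \<open>L.f.f.c.: locally finite with finite covers.\<close>

locale lffc_lattice = lattice +
  assumes finite_interval: "\<lbrakk>a \<in> carrier L; b \<in> carrier L\<rbrakk> \<Longrightarrow> finite \<lbrace>a..b\<rbrace>"
    and finite_upper_covers: "x \<in> carrier L \<Longrightarrow> finite {y. covers L x y}"
    and finite_lower_covers: "x \<in> carrier L \<Longrightarrow> finite {y. covers L y x}"

definition lattice_iso ::
    "('a, 'm) gorder_scheme \<Rightarrow> ('b, 'n) gorder_scheme \<Rightarrow> ('a \<Rightarrow> 'b) \<Rightarrow> bool"
  where "lattice_iso A B f \<longleftrightarrow>
    bij_betw f (carrier A) (carrier B) \<and> join_pres A B f \<and> meet_pres A B f"

definition lattice_isomorphic ::
    "('a, 'm) gorder_scheme \<Rightarrow> ('b, 'n) gorder_scheme \<Rightarrow> bool"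
  where "lattice_isomorphic A B \<longleftrightarrow> (\<exists>f. lattice_iso A B f)"


section \<open>Systems of lattices and their isomorphisms\<close>

text \<open>
  The fields \<open>upper_part S x y\<close> and \<open>lower_part S x y\<close> are the domain \<open>F\<close> (in the block at
  \<open>x\<close>) and the codomain \<open>I\<close> (in the block at \<open>y\<close>) of the connection from \<open>x\<close> to \<open>y\<close>. These
  two fields and \<open>conn\<close> are meaningful only at arguments related by \<open>tol_le\<close>.
\<close>

record ('s, 'a) lattice_system =
  skel :: "'s gorder"
  tol :: "'s \<Rightarrow> 's \<Rightarrow> bool"
  block :: "'s \<Rightarrow> 'a gorder"
  upper_part :: "'s \<Rightarrow> 's \<Rightarrow> 'a set"
  lower_part :: "'s \<Rightarrow> 's \<Rightarrow> 'a set"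
  conn :: "'s \<Rightarrow> 's \<Rightarrow> 'a \<Rightarrow> 'a"

definition tol_le :: "('s, 'a) lattice_system \<Rightarrow> 's \<Rightarrow> 's \<Rightarrow> bool"
  where "tol_le S x y \<longleftrightarrow> x \<in> carrier (skel S) \<and> y \<in> carrier (skel S)
    \<and> x \<sqsubseteq>\<^bsub>skel S\<^esub> y \<and> tol S x y"

definition system_iso ::
    "('s, 'a) lattice_system \<Rightarrow> ('t, 'b) lattice_system \<Rightarrow> ('s \<Rightarrow> 't) \<Rightarrow> ('s \<Rightarrow> 'a \<Rightarrow> 'b) \<Rightarrow> bool"
  where "system_iso S T h g \<longleftrightarrow>
    lattice_iso (skel S) (skel T) h
    \<and> (\<forall>x\<in>carrier (skel S). lattice_iso (block S x) (block T (h x)) (g x))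
    \<and> (\<forall>x\<in>carrier (skel S). \<forall>y\<in>carrier (skel S). tol S x y \<longleftrightarrow> tol T (h x) (h y))
    \<and> (\<forall>x y. tol_le S x y \<longrightarrow>
          upper_part T (h x) (h y) = g x ` upper_part S x y
        \<and> lower_part T (h x) (h y) = g y ` lower_part S x y
        \<and> (\<forall>a\<in>upper_part S x y. g y (conn S x y a) = conn T (h x) (h y) (g x a)))"

definition system_isomorphic ::
    "('s, 'a) lattice_system \<Rightarrow> ('t, 'b) lattice_system \<Rightarrow> bool"
  where "system_isomorphic S T \<longleftrightarrow> (\<exists>h g. system_iso S T h g)"


section \<open>Blocks, skeleton and dissection\<close>

definition is_interval :: "'a gorder \<Rightarrow> 'a set \<Rightarrow> bool"
  where "is_interval L B \<longleftrightarrow>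
    (\<exists>a\<in>carrier L. \<exists>b\<in>carrier L. a \<sqsubseteq>\<^bsub>L\<^esub> b \<and> B = \<lbrace>a..b\<rbrace>\<^bsub>L\<^esub>)"

abbreviation restrict_order :: "'a gorder \<Rightarrow> 'a set \<Rightarrow> 'a gorder"
  where "restrict_order L B \<equiv> L\<lparr>carrier := B\<rparr>"

abbreviation zero_of :: "'a gorder \<Rightarrow> 'a set \<Rightarrow> 'a"
  where "zero_of L B \<equiv> \<bottom>\<^bsub>restrict_order L B\<^esub>"

abbreviation one_of :: "'a gorder \<Rightarrow> 'a set \<Rightarrow> 'a"
  where "one_of L B \<equiv> \<top>\<^bsub>restrict_order L B\<^esub>"

definition complemented_interval :: "'a gorder \<Rightarrow> 'a set \<Rightarrow> bool"
  where "complemented_interval L B \<longleftrightarrow> is_interval L B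
    \<and> (\<forall>x\<in>B. \<exists>y\<in>B. x \<sqinter>\<^bsub>L\<^esub> y = zero_of L B \<and> x \<squnion>\<^bsub>L\<^esub> y = one_of L B)"

definition blocks :: "'a gorder \<Rightarrow> 'a set set"
  where "blocks L = {B. complemented_interval L B
    \<and> (\<forall>C. complemented_interval L C \<longrightarrow> B \<subseteq> C \<longrightarrow> C = B)}"

definition skeleton :: "'a gorder \<Rightarrow> 'a set gorder"
  where "skeleton L = \<lparr>carrier = blocks L, eq = (=), le = (\<lambda>B C. zero_of L B \<sqsubseteq>\<^bsub>L\<^esub> zero_of L C)\<rparr>"

definition dissection :: "'a gorder \<Rightarrow> ('a set, 'a) lattice_system"
  where "dissection L =
    \<lparr>skel = skeleton L,
     tol = (\<lambda>B C. B \<inter> C \<noteq> {}),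
     block = (\<lambda>B. restrict_order L B),
     upper_part = (\<lambda>B C. B \<inter> C),
     lower_part = (\<lambda>B C. B \<inter> C),
     conn = (\<lambda>B C a. a)\<rparr>"

end

theory Submission
  imports Defs
begin

text \<open>
  A lattice isomorphism transports every ingredient of the dissection; the substance is that
  the skeleton is a lattice at all. In a modular l.f.f.c. lattice an interval \<open>[a, b]\<close> is
  complemented iff \<open>b \<le> a\<^sup>*\<close> iff \<open>b\<^sub>* \<le> a\<close>, and complementation passes between the transposed
  intervals \<open>[a, a \<squnion> b]\<close> and \<open>[a \<sqinter> b, b]\<close>. Hence \<open>b\<^sub>* \<le> a\<close> iff \<open>b \<le> a\<^sup>*\<close> for arbitrary \<open>a\<close> and
  \<open>b\<close>: the two maps form a Galois connection. The blocks are the intervals \<open>[a, a\<^sup>*]\<close> with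
  \<open>(a\<^sup>*)\<^sub>* = a\<close>, so the skeleton is the set of fixed points of an interior operator on a lattice,
  and therefore a lattice itself.
\<close>

section \<open>Order isomorphisms of lattices\<close>

text \<open>Joins and meets are determined by the order, so a bijection that preserves and reflects
  the order preserves them. Isomorphisms on the skeleton and on the blocks can thus be checked on
  the order alone. That both sides are lattices is part of \<open>join_pres\<close> and
  \<open>meet_pres\<close>, so it has to be supplied separately.\<close>

lemma lattice_isoI:
  assumes A: "lattice A" and B: "lattice B"
    and bij: "bij_betw f (carrier A) (carrier B)"
    and le: "\<And>x y. \<lbrakk>x \<in> carrier A; y \<in> carrier A\<rbrakk> \<Longrightarrow> f x \<sqsubseteq>\<^bsub>B\<^esub> f y \<longleftrightarrow> x \<sqsubseteq>\<^bsub>A\<^esub> y"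
  shows "lattice_iso A B f"
proof -
  interpret A: lattice A by (rule A)
  interpret B: lattice B by (rule B)
  have closed: "f x \<in> carrier B" if "x \<in> carrier A" for x
    using bij that by (auto simp: bij_betw_def)
  have surj: "\<exists>x\<in>carrier A. f x = y" if "y \<in> carrier B" for y
    using bij that by (metis bij_betw_def imageE)
  have "f (x \<squnion>\<^bsub>A\<^esub> y) = f x \<squnion>\<^bsub>B\<^esub> f y" if xy: "x \<in> carrier A" "y \<in> carrier A" for x y
  proof -
    \<comment> \<open>The preimage of the join taken in \<open>B\<close>. It is an upper bound of
      \<open>x\<close> and \<open>y\<close> because \<open>f\<close> reflects the order.\<close>
    obtain z where z: "z \<in> carrier A" "f z = f x \<squnion>\<^bsub>B\<^esub> f y"
      using surj xy closed by (meson B.join_closed)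
    have "x \<sqsubseteq>\<^bsub>A\<^esub> z" "y \<sqsubseteq>\<^bsub>A\<^esub> z"
      using z xy le closed B.join_left B.join_right by metis+
    then have "f (x \<squnion>\<^bsub>A\<^esub> y) \<sqsubseteq>\<^bsub>B\<^esub> f z"
      using A.join_le xy z(1) le by auto
    moreover have "f z \<sqsubseteq>\<^bsub>B\<^esub> f (x \<squnion>\<^bsub>A\<^esub> y)"
      unfolding z using xy by (intro B.join_le) (auto simp: le closed A.join_left A.join_right)
    ultimately show ?thesis
      using z xy closed by (metis A.join_closed B.le_antisym)
  qed
  moreover have "f (x \<sqinter>\<^bsub>A\<^esub> y) = f x \<sqinter>\<^bsub>B\<^esub> f y" if xy: "x \<in> carrier A" "y \<in> carrier A" for x y
  proof -
    obtain z where z: "z \<in> carrier A" "f z = f x \<sqinter>\<^bsub>B\<^esub> f y"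
      using surj xy closed by (meson B.meet_closed)
    have "z \<sqsubseteq>\<^bsub>A\<^esub> x" "z \<sqsubseteq>\<^bsub>A\<^esub> y"
      using z xy le closed B.meet_left B.meet_right by metis+
    then have "f z \<sqsubseteq>\<^bsub>B\<^esub> f (x \<sqinter>\<^bsub>A\<^esub> y)"
      using A.meet_le xy z(1) le by auto
    moreover have "f (x \<sqinter>\<^bsub>A\<^esub> y) \<sqsubseteq>\<^bsub>B\<^esub> f z"
      unfolding z using xy by (intro B.meet_le) (auto simp: le closed A.meet_left A.meet_right)
    ultimately show ?thesis
      using z xy closed by (metis A.meet_closed B.le_antisym)
  qed
  ultimately show ?thesis
    using A B bij by (simp add: lattice_iso_def join_pres_def meet_pres_def)
qed

text \<open>\<open>x \<sqsubseteq> y\<close> is the equation \<open>x = x \<sqinter> y\<close>,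
  which an injective map preserving meets both preserves and reflects.\<close>

lemma lattice_iso_le_iff:
  assumes f: "lattice_iso A B f" and xy: "x \<in> carrier A" "y \<in> carrier A"
  shows "f x \<sqsubseteq>\<^bsub>B\<^esub> f y \<longleftrightarrow> x \<sqsubseteq>\<^bsub>A\<^esub> y"
proof -
  from f interpret A: lattice A by (simp add: lattice_iso_def join_pres_def)
  from f interpret B: lattice B by (simp add: lattice_iso_def join_pres_def)
  have inj: "inj_on f (carrier A)" and "f x \<in> carrier B" "f y \<in> carrier B"
    using f xy by (auto simp: lattice_iso_def bij_betw_def)
  then have "f x \<sqsubseteq>\<^bsub>B\<^esub> f y \<longleftrightarrow> f x = f (x \<sqinter>\<^bsub>A\<^esub> y)"
    using f xy B.le_iff_join by (simp add: lattice_iso_def meet_pres_def)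
  also have "\<dots> \<longleftrightarrow> x \<sqsubseteq>\<^bsub>A\<^esub> y"
    using inj xy A.le_iff_join by (auto dest: inj_onD)
  finally show ?thesis .
qed

lemma lattice_iso_inv_into:
  assumes "lattice_iso A B f"
  shows "lattice_iso B A (inv_into (carrier A) f)"
proof (rule lattice_isoI)
  show "lattice B" "lattice A"
    using assms by (auto simp: lattice_iso_def join_pres_def)
  have bij: "bij_betw f (carrier A) (carrier B)"
    using assms by (simp add: lattice_iso_def)
  then show "bij_betw (inv_into (carrier A) f) (carrier B) (carrier A)"
    by (rule bij_betw_inv_into)
  fix x y assume "x \<in> carrier B" "y \<in> carrier B"
  then show "inv_into (carrier A) f x \<sqsubseteq>\<^bsub>A\<^esub> inv_into (carrier A) f y \<longleftrightarrow> x \<sqsubseteq>\<^bsub>B\<^esub> y"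
    using bij lattice_iso_le_iff[OF assms]
    by (metis bij_betw_def f_inv_into_f inv_into_into)
qed


section \<open>Complemented intervals\<close>

context lattice
begin

lemma join_assoc:
  "\<lbrakk>x \<in> carrier L; y \<in> carrier L; z \<in> carrier L\<rbrakk> \<Longrightarrow> (x \<squnion> y) \<squnion> z = x \<squnion> (y \<squnion> z)"
  using weak_join_assoc by (simp add: eq_is_equal)

lemma meet_assoc:
  "\<lbrakk>x \<in> carrier L; y \<in> carrier L; z \<in> carrier L\<rbrakk> \<Longrightarrow> (x \<sqinter> y) \<sqinter> z = x \<sqinter> (y \<sqinter> z)"
  using weak_meet_assoc by (simp add: eq_is_equal)

lemma join_absorb1: "\<lbrakk>x \<sqsubseteq> y; x \<in> carrier L; y \<in> carrier L\<rbrakk> \<Longrightarrow> x \<squnion> y = y"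
  using le_iff_meet by simp

lemma join_absorb2: "\<lbrakk>x \<sqsubseteq> y; x \<in> carrier L; y \<in> carrier L\<rbrakk> \<Longrightarrow> y \<squnion> x = y"
  using join_absorb1 join_comm by metis

lemma meet_absorb1: "\<lbrakk>x \<sqsubseteq> y; x \<in> carrier L; y \<in> carrier L\<rbrakk> \<Longrightarrow> x \<sqinter> y = x"
  using le_iff_join by simp

lemma meet_absorb2: "\<lbrakk>x \<sqsubseteq> y; x \<in> carrier L; y \<in> carrier L\<rbrakk> \<Longrightarrow> y \<sqinter> x = x"
  using meet_absorb1 meet_comm by metis

lemma le_joinI1:
  "\<lbrakk>x \<sqsubseteq> y; x \<in> carrier L; y \<in> carrier L; z \<in> carrier L\<rbrakk> \<Longrightarrow> x \<sqsubseteq> y \<squnion> z"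
  by (rule le_trans[OF _ join_left]) auto

lemma le_joinI2:
  "\<lbrakk>x \<sqsubseteq> z; x \<in> carrier L; y \<in> carrier L; z \<in> carrier L\<rbrakk> \<Longrightarrow> x \<sqsubseteq> y \<squnion> z"
  by (rule le_trans[OF _ join_right]) auto

lemma meet_leI1:
  "\<lbrakk>x \<sqsubseteq> z; x \<in> carrier L; y \<in> carrier L; z \<in> carrier L\<rbrakk> \<Longrightarrow> x \<sqinter> y \<sqsubseteq> z"
  by (rule le_trans[OF meet_left]) auto

lemma meet_leI2:
  "\<lbrakk>y \<sqsubseteq> z; x \<in> carrier L; y \<in> carrier L; z \<in> carrier L\<rbrakk> \<Longrightarrow> x \<sqinter> y \<sqsubseteq> z"
  by (rule le_trans[OF meet_right]) auto

end

lemma (in weak_partial_order) interval_mono: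
  assumes "a' \<sqsubseteq> a" "b \<sqsubseteq> b'" "a \<in> carrier L" "b \<in> carrier L" "a' \<in> carrier L" "b' \<in> carrier L"
  shows "\<lbrace>a..b\<rbrace> \<subseteq> \<lbrace>a'..b'\<rbrace>"
  using assms le_trans[of a' a] le_trans[of _ b b'] by (auto simp: at_least_at_most_def)

text \<open>Complementation of an interval in terms of its two endpoints. In
  \<open>complemented_interval\<close> the ends have to be recovered from the set by a choice of
  bottom and top; here they are explicit, and order duality merely swaps them.\<close>

definition compl :: "('a, 'm) gorder_scheme \<Rightarrow> 'a \<Rightarrow> 'a \<Rightarrow> bool"
  where "compl L a b \<longleftrightarrow> a \<in> carrier L \<and> b \<in> carrier L \<and> a \<sqsubseteq>\<^bsub>L\<^esub> b
    \<and> (\<forall>x\<in>\<lbrace>a..b\<rbrace>\<^bsub>L\<^esub>. \<exists>y\<in>\<lbrace>a..b\<rbrace>\<^bsub>L\<^esub>. x \<sqinter>\<^bsub>L\<^esub> y = a \<and> x \<squnion>\<^bsub>L\<^esub> y = b)"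

lemma mem_interval_iff: "x \<in> \<lbrace>a..b\<rbrace>\<^bsub>L\<^esub> \<longleftrightarrow> x \<in> carrier L \<and> a \<sqsubseteq>\<^bsub>L\<^esub> x \<and> x \<sqsubseteq>\<^bsub>L\<^esub> b"
  by (simp add: at_least_at_most_def)

lemma compl_E:
  assumes "compl L a b" "x \<in> carrier L" "a \<sqsubseteq>\<^bsub>L\<^esub> x" "x \<sqsubseteq>\<^bsub>L\<^esub> b"
  obtains y where "y \<in> carrier L" "a \<sqsubseteq>\<^bsub>L\<^esub> y" "y \<sqsubseteq>\<^bsub>L\<^esub> b"
    "x \<sqinter>\<^bsub>L\<^esub> y = a" "x \<squnion>\<^bsub>L\<^esub> y = b"
proof -
  have "x \<in> \<lbrace>a..b\<rbrace>\<^bsub>L\<^esub>"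
    using assms by (simp add: mem_interval_iff)
  then have "\<exists>y\<in>\<lbrace>a..b\<rbrace>\<^bsub>L\<^esub>. x \<sqinter>\<^bsub>L\<^esub> y = a \<and> x \<squnion>\<^bsub>L\<^esub> y = b"
    using assms(1) by (simp add: compl_def)
  then show thesis
    using that by (auto simp: mem_interval_iff)
qed

lemma interval_dual: "\<lbrace>a..b\<rbrace>\<^bsub>inv_gorder L\<^esub> = \<lbrace>b..a\<rbrace>\<^bsub>L\<^esub>"
  by (auto simp: at_least_at_most_def)

lemma compl_dual: "compl (inv_gorder L) a b \<longleftrightarrow> compl L b a"
  unfolding compl_def interval_dual by auto

lemma (in partial_order) zero_of_interval:
  assumes "a \<in> carrier L" "b \<in> carrier L" "a \<sqsubseteq> b"
  shows "\<bottom>\<^bsub>L\<lparr>carrier := \<lbrace>a..b\<rbrace>\<rparr>\<^esub> = a"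
  unfolding bottom_def
  by (rule some_equality) (use assms in \<open>auto simp: least_def mem_interval_iff intro!: le_antisym\<close>)

lemma (in partial_order) one_of_interval:
  assumes "a \<in> carrier L" "b \<in> carrier L" "a \<sqsubseteq> b"
  shows "\<top>\<^bsub>L\<lparr>carrier := \<lbrace>a..b\<rbrace>\<rparr>\<^esub> = b"
  unfolding top_def
  by (rule some_equality) (use assms in \<open>auto simp: greatest_def mem_interval_iff intro!: le_antisym\<close>)

lemma complemented_interval_iff:
  assumes "partial_order L"
  shows "complemented_interval L B \<longleftrightarrow> (\<exists>a b. compl L a b \<and> B = \<lbrace>a..b\<rbrace>\<^bsub>L\<^esub>)"
  (is "?l \<longleftrightarrow> ?r")
proof -
  interpret partial_order L by (rule assms)
  show ?thesis
  proof
    assume ?l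
    then obtain a b where ab: "a \<in> carrier L" "b \<in> carrier L" "a \<sqsubseteq>\<^bsub>L\<^esub> b" "B = \<lbrace>a..b\<rbrace>\<^bsub>L\<^esub>"
      by (auto simp: complemented_interval_def is_interval_def)
    then show ?r
      using \<open>?l\<close> zero_of_interval[OF ab(1-3)] one_of_interval[OF ab(1-3)]
      unfolding complemented_interval_def compl_def by metis
  next
    assume ?r
    then obtain a b where c: "compl L a b" and B: "B = \<lbrace>a..b\<rbrace>\<^bsub>L\<^esub>"
      by blast
    then have ab: "a \<in> carrier L" "b \<in> carrier L" "a \<sqsubseteq>\<^bsub>L\<^esub> b"
      by (auto simp: compl_def)
    show ?l
      using c ab zero_of_interval[OF ab] one_of_interval[OF ab]
      unfolding complemented_interval_def compl_def is_interval_def B by metis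
  qed
qed

lemma (in lattice) interval_lattice:
  assumes "a \<in> carrier L" "b \<in> carrier L" "a \<sqsubseteq> b"
  shows "lattice (L\<lparr>carrier := \<lbrace>a..b\<rbrace>\<rparr>)"
proof -
  let ?I = "L\<lparr>carrier := \<lbrace>a..b\<rbrace>\<rparr>"
  interpret I: weak_partial_order ?I
    by (rule weak_partial_order_subset)
      (auto simp: mem_interval_iff weak_partial_order_axioms)
  interpret I: partial_order ?I
    by unfold_locales (simp add: eq_is_equal)
  show ?thesis
  proof
    fix x y assume "x \<in> carrier ?I" "y \<in> carrier ?I"
    then have xy: "x \<in> carrier L" "y \<in> carrier L" "a \<sqsubseteq> x" "a \<sqsubseteq> y" "x \<sqsubseteq> b" "y \<sqsubseteq> b"
      by (auto simp: mem_interval_iff)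
    have "a \<sqsubseteq> x \<squnion> y" "x \<sqinter> y \<sqsubseteq> b"
      using xy assms by (auto intro: le_joinI1 meet_leI1)
    then have jm: "x \<squnion> y \<in> \<lbrace>a..b\<rbrace>" "x \<sqinter> y \<in> \<lbrace>a..b\<rbrace>"
      using xy assms by (auto simp: mem_interval_iff intro: join_le meet_le)
    have "is_lub ?I (x \<squnion> y) {x, y}"
      using jm xy
      by (intro least_UpperI) (auto simp: mem_interval_iff Upper_def join_left join_right
          intro!: join_le)
    then show "\<exists>s. is_lub ?I s {x, y}" ..
    have "is_glb ?I (x \<sqinter> y) {x, y}"
      using jm xy
      by (intro greatest_LowerI) (auto simp: mem_interval_iff Lower_def meet_left meet_right
          intro!: meet_le)
    then show "\<exists>s. is_glb ?I s {x, y}" ..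
  qed
qed


section \<open>The Galois connection in a modular l.f.f.c. lattice\<close>

context modular_lattice
begin

lemma dual_modular_lattice: "modular_lattice (inv_gorder L)"
proof -
  interpret dual: partial_order "inv_gorder L" by (rule dual_order)
  show ?thesis
  proof
    fix x y z assume "x \<in> carrier (inv_gorder L)" "y \<in> carrier (inv_gorder L)"
      "z \<in> carrier (inv_gorder L)" "x \<sqsubseteq>\<^bsub>inv_gorder L\<^esub> z"
    then show "x \<squnion>\<^bsub>inv_gorder L\<^esub> (y \<sqinter>\<^bsub>inv_gorder L\<^esub> z)
        = (x \<squnion>\<^bsub>inv_gorder L\<^esub> y) \<sqinter>\<^bsub>inv_gorder L\<^esub> z"
      using modular[of z y x] by (simp add: join_comm meet_comm)
  qed (simp_all add: sup_of_two_exists inf_of_two_exists)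
qed

text \<open>If \<open>y\<close> complements \<open>x\<close> in the large interval, then
  \<open>a' \<squnion> (y \<sqinter> b')\<close> complements it in the small one. By modularity this
  element equals \<open>(a' \<squnion> y) \<sqinter> b'\<close>; the first form serves to compute
  the join with \<open>x\<close>, the second the meet.\<close>

lemma compl_subinterval:
  assumes c: "compl L a b" and a': "a' \<in> carrier L" and b': "b' \<in> carrier L"
    and le: "a \<sqsubseteq> a'" "a' \<sqsubseteq> b'" "b' \<sqsubseteq> b"
  shows "compl L a' b'"
  unfolding compl_def
proof (intro conjI ballI a' b' le)
  have ab: "a \<in> carrier L" "b \<in> carrier L"
    using c by (auto simp: compl_def)
  fix x assume "x \<in> \<lbrace>a'..b'\<rbrace>"
  then have x: "x \<in> carrier L" "a' \<sqsubseteq> x" "x \<sqsubseteq> b'"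
    by (auto simp: mem_interval_iff)
  then have "a \<sqsubseteq> x" "x \<sqsubseteq> b"
    using ab a' b' le le_trans by metis+
  with c x(1) obtain y where y: "y \<in> carrier L" "x \<sqinter> y = a" "x \<squnion> y = b"
    by (rule compl_E)
  define z where "z = a' \<squnion> (y \<sqinter> b')"
  have z: "z = (a' \<squnion> y) \<sqinter> b'"
    unfolding z_def using modular a' b' y le by simp
  have zc: "z \<in> carrier L" unfolding z_def using a' b' y by simp
  have "x \<sqinter> z = (a' \<squnion> y) \<sqinter> (b' \<sqinter> x)"
    unfolding z meet_comm[of L x] using a' b' y x
    by (simp add: meet_assoc[symmetric] meet_comm[of L x])
  also have "b' \<sqinter> x = x"
    using x b' by (simp add: meet_absorb2)
  also have "(a' \<squnion> y) \<sqinter> x = a' \<squnion> (y \<sqinter> x)"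
    using modular[of a' y x] a' y x by simp
  also have "\<dots> = a'"
    using y ab a' le by (simp add: meet_comm[of L y] join_absorb2)
  finally have m: "x \<sqinter> z = a'" .
  have "x \<squnion> z = (x \<squnion> a') \<squnion> (y \<sqinter> b')"
    unfolding z_def using a' b' y x join_assoc by simp
  also have "x \<squnion> a' = x"
    using x a' by (simp add: join_absorb2)
  also have "x \<squnion> (y \<sqinter> b') = (x \<squnion> y) \<sqinter> b'"
    using modular x y b' by simp
  also have "\<dots> = b'"
    using y ab b' le by (simp add: meet_absorb2)
  finally have "x \<squnion> z = b'" .
  moreover have "z \<in> \<lbrace>a'..b'\<rbrace>"
    using zc z_def z a' b' y join_left[of a' "y \<sqinter> b'"] meet_right[of "a' \<squnion> y" b']
    by (simp add: mem_interval_iff)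
  ultimately show "\<exists>y\<in>\<lbrace>a'..b'\<rbrace>. x \<sqinter> y = a' \<and> x \<squnion> y = b'"
    using m by blast
qed

text \<open>One direction of the transposition of intervals in a modular lattice: lift
  \<open>x\<close> to \<open>x \<squnion> a\<close>, take a complement \<open>y\<close> there, and
  bring it back down as \<open>y \<sqinter> b\<close>.\<close>

lemma compl_transpose:
  assumes c: "compl L a (a \<squnion> b)" and b: "b \<in> carrier L"
  shows "compl L (a \<sqinter> b) b"
proof -
  have a: "a \<in> carrier L"
    using c by (auto simp: compl_def)
  show ?thesis
    unfolding compl_def
  proof (intro conjI ballI b meet_closed a meet_right)
    fix x assume "x \<in> \<lbrace>a \<sqinter> b..b\<rbrace>"
    then have x: "x \<in> carrier L" "a \<sqinter> b \<sqsubseteq> x" "x \<sqsubseteq> b"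
      by (auto simp: mem_interval_iff)
    have "x \<squnion> a \<sqsubseteq> a \<squnion> b"
      using x a b by (auto intro: join_le le_joinI2 join_left)
    with c obtain y where y: "y \<in> carrier L" "a \<sqsubseteq> y" "(x \<squnion> a) \<sqinter> y = a" "(x \<squnion> a) \<squnion> y = a \<squnion> b"
      using x a b join_right by (auto elim: compl_E[of L a "a \<squnion> b" "x \<squnion> a"])
    have yb: "y \<sqinter> b \<in> carrier L" "a \<sqinter> b \<sqsubseteq> y \<sqinter> b"
      using a b y meet_leI1[of a y b] by (auto intro: meet_le meet_right)
    have "x \<sqinter> (y \<sqinter> b) \<sqsubseteq> (x \<squnion> a) \<sqinter> y"
      using x y a b by (intro meet_le meet_leI1 meet_leI2 le_joinI1) auto
    then have "x \<sqinter> (y \<sqinter> b) \<sqsubseteq> a"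
      unfolding y(3) .
    moreover have "x \<sqinter> (y \<sqinter> b) \<sqsubseteq> b"
      using x y b by (intro meet_leI1) auto
    ultimately have "x \<sqinter> (y \<sqinter> b) \<sqsubseteq> a \<sqinter> b"
      using x y a b by (intro meet_le) auto
    moreover have "a \<sqinter> b \<sqsubseteq> x \<sqinter> (y \<sqinter> b)"
      using x y a b yb by (simp add: meet_le)
    ultimately have m: "x \<sqinter> (y \<sqinter> b) = a \<sqinter> b"
      using x y a b by (intro le_antisym) auto
    \<comment> \<open>The lifting of \<open>x\<close> does not matter for the join, because
      \<open>a \<sqsubseteq> y\<close>. Modularity, with \<open>x \<sqsubseteq> b\<close>, then
      turns \<open>x \<squnion> (y \<sqinter> b)\<close> into
      \<open>(a \<squnion> b) \<sqinter> b\<close>.\<close>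
    have "x \<squnion> y = a \<squnion> b"
      using y x a by (simp add: join_assoc join_absorb1)
    then have "x \<squnion> (y \<sqinter> b) = b"
      using modular[of x y b] x y a b by (simp add: meet_absorb2 join_right)
    with m yb show "\<exists>y\<in>\<lbrace>a \<sqinter> b..b\<rbrace>. x \<sqinter> y = a \<sqinter> b \<and> x \<squnion> y = b"
      using y b by (auto simp: mem_interval_iff meet_right)
  qed
qed

end

section \<open>Duality, covers, and the two star operators\<close>

lemma covers_dual:
  assumes "partial_order L"
  shows "covers (inv_gorder L) x y \<longleftrightarrow> covers L y x"
proof -
  interpret partial_order L by (rule assms)
  show ?thesis
    by (auto simp: covers_def lless_def eq_is_equal)
qed

lemma (in lffc_lattice) dual_lffc_lattice: "lffc_lattice (inv_gorder L)"
proof -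
  interpret dual: partial_order "inv_gorder L" by (rule dual_order)
  show ?thesis
    by unfold_locales (simp_all add: sup_of_two_exists inf_of_two_exists interval_dual
        finite_interval finite_upper_covers finite_lower_covers covers_dual[OF partial_order_axioms])
qed

text \<open>Inserting \<open>x\<close> covers both cases of the informal definition: a top element
  has no upper covers and gets \<open>x\<close> itself, while elsewhere \<open>x\<close> lies below
  its covers and does not change their join. It also keeps the set nonempty.\<close>

definition upper_star :: "('a, 'm) gorder_scheme \<Rightarrow> 'a \<Rightarrow> 'a"
  where "upper_star L x = \<Squnion>\<^bsub>L\<^esub>(insert x {y. covers L x y})"

definition lower_star :: "('a, 'm) gorder_scheme \<Rightarrow> 'a \<Rightarrow> 'a"
  where "lower_star L x = \<Sqinter>\<^bsub>L\<^esub>(insert x {y. covers L y x})"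

locale modular_lffc_lattice = modular_lattice L + lffc_lattice L
  for L :: "'a gorder" (structure)
begin

text \<open>All hypotheses are self-dual, so each fact about \<open>upper_star\<close> yields its
  counterpart for \<open>lower_star\<close> by passing to \<open>inv_gorder L\<close>.\<close>

lemma dual_modular_lffc_lattice: "modular_lffc_lattice (inv_gorder L)"
  by (intro modular_lffc_lattice.intro dual_modular_lattice dual_lffc_lattice)

lemma upper_star_dual: "upper_star (inv_gorder L) x = lower_star L x"
  by (simp add: upper_star_def lower_star_def covers_dual[OF partial_order_axioms])

lemma lower_star_dual: "lower_star (inv_gorder L) x = upper_star L x"
  by (simp add: upper_star_def lower_star_def covers_dual[OF partial_order_axioms])

lemma upper_star_lub:
  assumes "a \<in> carrier L"
  shows "is_lub L (upper_star L a) (insert a {y. covers L a y})"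
  unfolding upper_star_def using assms
  by (intro finite_sup_least) (auto simp: finite_upper_covers covers_def)

lemma upper_star_closed [simp]: "a \<in> carrier L \<Longrightarrow> upper_star L a \<in> carrier L"
  using upper_star_lub by blast

lemma le_upper_star: "a \<in> carrier L \<Longrightarrow> a \<sqsubseteq> upper_star L a"
  using upper_star_lub by (auto simp: least_def Upper_def)

lemma cover_le_upper_star: "covers L a p \<Longrightarrow> p \<sqsubseteq> upper_star L a"
  using upper_star_lub by (auto simp: least_def Upper_def covers_def)

lemma upper_star_least:
  assumes "a \<in> carrier L" "z \<in> carrier L" "a \<sqsubseteq> z" "\<And>p. covers L a p \<Longrightarrow> p \<sqsubseteq> z"
  shows "upper_star L a \<sqsubseteq> z"
  using upper_star_lub[OF assms(1)] assms by (auto simp: least_def Upper_def)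

text \<open>If \<open>y\<close> is not itself a cover of \<open>a\<close>, some \<open>z\<close>
  lies strictly between them, and the finite interval from \<open>a\<close> to \<open>z\<close> is
  smaller than the one from \<open>a\<close> to \<open>y\<close>.\<close>

lemma ex_cover_le:
  assumes "a \<in> carrier L" "y \<in> carrier L" "a \<sqsubseteq> y" "a \<noteq> y"
  shows "\<exists>p. covers L a p \<and> p \<sqsubseteq> y"
  using assms(2-)
proof (induction "card \<lbrace>a..y\<rbrace>" arbitrary: y rule: less_induct)
  case less
  show ?case
  proof (cases "covers L a y")
    case True
    then show ?thesis using less by auto
  next
    case False
    then obtain z where z: "z \<in> carrier L" "a \<sqsubseteq> z" "a \<noteq> z" "z \<sqsubseteq> y" "z \<noteq> y"
      using less assms(1) by (auto simp: covers_def lless_eq)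
    have "\<lbrace>a..z\<rbrace> \<subseteq> \<lbrace>a..y\<rbrace>"
      using z less.prems by (auto simp: mem_interval_iff intro: le_trans)
    moreover have "y \<in> \<lbrace>a..y\<rbrace>" "y \<notin> \<lbrace>a..z\<rbrace>"
      using z less.prems by (auto simp: mem_interval_iff)
    ultimately have "card \<lbrace>a..z\<rbrace> < card \<lbrace>a..y\<rbrace>"
      using finite_interval assms(1) less.prems by (intro psubset_card_mono) auto
    then obtain p where "covers L a p" "p \<sqsubseteq> z"
      using less.hyps z by blast
    then show ?thesis
      using z less.prems le_trans by (metis covers_def)
  qed
qed

text \<open>The covers of \<open>a\<close> are the atoms of this interval and their join is its top.
  For given \<open>x\<close>, an element \<open>y\<close> maximal with
  \<open>x \<sqinter> y = a\<close> is a complement: a cover of \<open>a\<close> not below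
  \<open>x \<squnion> y\<close> could be joined to \<open>y\<close> without enlarging the meet with
  \<open>x\<close>.\<close>

lemma compl_upper_star:
  assumes a: "a \<in> carrier L"
  shows "compl L a (upper_star L a)"
  unfolding compl_def
proof (intro conjI ballI a upper_star_closed le_upper_star)
  let ?s = "upper_star L a"
  fix x assume "x \<in> \<lbrace>a..?s\<rbrace>"
  then have x: "x \<in> carrier L" "a \<sqsubseteq> x" "x \<sqsubseteq> ?s"
    by (auto simp: mem_interval_iff)
  define P where "P y \<longleftrightarrow> y \<in> \<lbrace>a..?s\<rbrace> \<and> x \<sqinter> y = a" for y
  have "P a"
    using a x le_upper_star by (auto simp: P_def mem_interval_iff) (metis le_iff_join meet_comm)
  \<comment> \<open>Making the finite interval above \<open>y\<close> as small as possible is what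
    provides a maximal \<open>y\<close>.\<close>
  then obtain y where Py: "P y" and min: "\<And>z. P z \<Longrightarrow> card \<lbrace>y..?s\<rbrace> \<le> card \<lbrace>z..?s\<rbrace>"
    using ex_has_least_nat[of P a "\<lambda>y. card \<lbrace>y..?s\<rbrace>"] by blast
  then have y: "y \<in> carrier L" "a \<sqsubseteq> y" "y \<sqsubseteq> ?s" "x \<sqinter> y = a"
    by (auto simp: P_def mem_interval_iff)
  have "x \<squnion> y = ?s"
  proof (rule ccontr)
    assume ne: "x \<squnion> y \<noteq> ?s"
    have xy: "x \<squnion> y \<in> carrier L" "x \<squnion> y \<sqsubseteq> ?s" "a \<sqsubseteq> x \<squnion> y"
      using x y a by (auto intro: join_le le_joinI1)
    with ne have "\<not> ?s \<sqsubseteq> x \<squnion> y"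
      using a by (auto intro: le_antisym)
    then obtain p where p: "covers L a p" "\<not> p \<sqsubseteq> x \<squnion> y"
      using upper_star_least a xy by blast
    then have pc: "p \<in> carrier L" "a \<sqsubseteq> p" "p \<sqsubseteq> ?s"
      using cover_le_upper_star by (auto simp: covers_def lless_eq)
    have "p \<sqinter> (x \<squnion> y) \<noteq> p"
      using p pc xy meet_right by metis
    moreover have "a \<sqsubseteq> p \<sqinter> (x \<squnion> y)" "p \<sqinter> (x \<squnion> y) \<sqsubseteq> p"
      using pc xy a by (auto intro: meet_le meet_left)
    \<comment> \<open>Nothing lies strictly between \<open>a\<close> and its cover \<open>p\<close>,
      and \<open>p\<close> is not below \<open>x \<squnion> y\<close>.\<close>
    ultimately have pa: "p \<sqinter> (x \<squnion> y) = a"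
      using p(1) xy pc by (auto simp: covers_def lless_eq)
    have yp: "y \<squnion> p \<in> carrier L" "y \<squnion> p \<sqsubseteq> ?s" "a \<sqsubseteq> y \<squnion> p"
      using pc y a by (auto intro: join_le le_joinI1)
    \<comment> \<open>Modularity with \<open>y \<sqsubseteq> x \<squnion> y\<close>. The outcome
      \<open>y\<close> bounds \<open>x \<sqinter> (y \<squnion> p)\<close>, so this meet is still
      \<open>a\<close>, although \<open>y \<squnion> p\<close> is strictly above
      \<open>y\<close>.\<close>
    have "(y \<squnion> p) \<sqinter> (x \<squnion> y) = y \<squnion> (p \<sqinter> (x \<squnion> y))"
      using modular[of y p "x \<squnion> y"] y pc x join_right by simp
    also have "\<dots> = y"
      unfolding pa using y a by (simp add: join_absorb2)
    finally have y': "(y \<squnion> p) \<sqinter> (x \<squnion> y) = y" .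
    have "x \<sqinter> (y \<squnion> p) \<sqsubseteq> (y \<squnion> p) \<sqinter> (x \<squnion> y)"
      using x y yp xy by (intro meet_le meet_right meet_leI1 join_left) auto
    then have "x \<sqinter> (y \<squnion> p) \<sqsubseteq> x \<sqinter> y"
      unfolding y' using x y yp by (intro meet_le meet_left) auto
    then have "x \<sqinter> (y \<squnion> p) \<sqsubseteq> a"
      unfolding y(4) .
    moreover have "a \<sqsubseteq> x \<sqinter> (y \<squnion> p)"
      using x yp a by (intro meet_le) auto
    ultimately have "x \<sqinter> (y \<squnion> p) = a"
      using a x yp by (intro le_antisym) auto
    with yp have "P (y \<squnion> p)"
      by (simp add: P_def mem_interval_iff)
    then have le: "card \<lbrace>y..?s\<rbrace> \<le> card \<lbrace>y \<squnion> p..?s\<rbrace>"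
      by (rule min)
    have "\<not> p \<sqsubseteq> y"
      using p pc x y le_joinI2 by metis
    then have "\<not> y \<squnion> p \<sqsubseteq> y"
      using pc y yp le_trans[OF join_right] by metis
    then have "y \<in> \<lbrace>y..?s\<rbrace>" "y \<notin> \<lbrace>y \<squnion> p..?s\<rbrace>"
      using y by (auto simp: mem_interval_iff)
    moreover have "\<lbrace>y \<squnion> p..?s\<rbrace> \<subseteq> \<lbrace>y..?s\<rbrace>"
      using y yp pc a by (intro interval_mono join_left) auto
    ultimately have "\<lbrace>y \<squnion> p..?s\<rbrace> \<subset> \<lbrace>y..?s\<rbrace>"
      by blast
    then have "card \<lbrace>y \<squnion> p..?s\<rbrace> < card \<lbrace>y..?s\<rbrace>"
      using finite_interval y a by (intro psubset_card_mono) auto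
    with le show False by simp
  qed
  with y show "\<exists>y\<in>\<lbrace>a..?s\<rbrace>. x \<sqinter> y = a \<and> x \<squnion> y = ?s"
    by (auto simp: mem_interval_iff)
qed

text \<open>Let \<open>y\<close> complement \<open>b \<sqinter> upper_star L a\<close> in the
  interval. If \<open>y\<close> were above \<open>a\<close>, some cover of \<open>a\<close> would
  lie below \<open>y\<close>, and being below both \<open>b\<close> and the star it would lie below
  the meet of the two complements, which is \<open>a\<close>. Hence \<open>y = a\<close>, and the
  join of the complements shows that \<open>b\<close> is below the star.\<close>

lemma compl_le_upper_star:
  assumes c: "compl L a b"
  shows "b \<sqsubseteq> upper_star L a"
proof -
  let ?d = "b \<sqinter> upper_star L a"
  have ab: "a \<in> carrier L" "b \<in> carrier L" "a \<sqsubseteq> b"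
    using c by (auto simp: compl_def)
  then have d: "?d \<in> \<lbrace>a..b\<rbrace>"
    by (auto simp: mem_interval_iff intro: meet_left meet_le le_upper_star)
  then obtain y where y: "y \<in> carrier L" "a \<sqsubseteq> y" "y \<sqsubseteq> b" "?d \<sqinter> y = a" "?d \<squnion> y = b"
    using compl_E[OF c] unfolding mem_interval_iff by metis
  have "a = y"
  proof (rule ccontr)
    assume "a \<noteq> y"
    then obtain p where p: "covers L a p" "p \<sqsubseteq> y"
      using ex_cover_le ab y by blast
    then have pc: "p \<in> carrier L" "a \<sqsubseteq> p" "a \<noteq> p"
      by (auto simp: covers_def lless_eq)
    have "p \<sqsubseteq> b"
      using pc p y ab le_trans by metis
    then have "p \<sqsubseteq> ?d \<sqinter> y"
      using p pc y(1,2) ab cover_le_upper_star by (intro meet_le) auto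
    then show False
      unfolding y(4) using pc ab le_antisym by metis
  qed
  then have "b = ?d"
    using y ab d by (simp add: mem_interval_iff join_absorb2)
  then show ?thesis
    using ab meet_right[of b "upper_star L a"] by simp
qed

section \<open>Complementation through the stars, and the Galois connection\<close>

lemma compl_iff_le_upper_star:
  assumes "a \<in> carrier L" "b \<in> carrier L"
  shows "compl L a b \<longleftrightarrow> a \<sqsubseteq> b \<and> b \<sqsubseteq> upper_star L a"
  using assms compl_le_upper_star compl_subinterval[OF compl_upper_star]
  by (auto simp: compl_def)

lemma lower_star_closed [simp]: "a \<in> carrier L \<Longrightarrow> lower_star L a \<in> carrier L"
  using modular_lffc_lattice.upper_star_closed[OF dual_modular_lffc_lattice]
  by (simp add: upper_star_dual)

lemma compl_iff_lower_star_le: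
  assumes "a \<in> carrier L" "b \<in> carrier L"
  shows "compl L a b \<longleftrightarrow> a \<sqsubseteq> b \<and> lower_star L b \<sqsubseteq> a"
  using modular_lffc_lattice.compl_iff_le_upper_star[OF dual_modular_lffc_lattice, of b a] assms
  by (simp add: compl_dual upper_star_dual)

text \<open>The elements need not be comparable: the upper star controls the interval from
  \<open>a\<close> to \<open>a \<squnion> b\<close>, the lower star the one from
  \<open>a \<sqinter> b\<close> to \<open>b\<close>, and transposition links the two.\<close>

lemma lower_star_le_of_le_upper_star:
  assumes a: "a \<in> carrier L" and b: "b \<in> carrier L" and le: "b \<sqsubseteq> upper_star L a"
  shows "lower_star L b \<sqsubseteq> a"
proof -
  have "compl L a (a \<squnion> b)"
    using a b le by (simp add: compl_iff_le_upper_star join_left join_le le_upper_star)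
  then have "compl L (a \<sqinter> b) b"
    using b by (rule compl_transpose)
  then have "lower_star L b \<sqsubseteq> a \<sqinter> b"
    using a b by (simp add: compl_iff_lower_star_le)
  then show ?thesis
    using a b le_trans[OF _ meet_left] by simp
qed

lemma star_galois:
  assumes "a \<in> carrier L" "b \<in> carrier L"
  shows "lower_star L b \<sqsubseteq> a \<longleftrightarrow> b \<sqsubseteq> upper_star L a"
  using lower_star_le_of_le_upper_star assms
    modular_lffc_lattice.lower_star_le_of_le_upper_star[OF dual_modular_lffc_lattice, of b a]
  by (auto simp: upper_star_dual lower_star_dual)

text \<open>Monotonicity is formal for either half of a Galois connection; covers of
  \<open>a\<close> and of \<open>b\<close> are never compared.\<close>

lemma upper_star_mono:
  assumes "a \<in> carrier L" "b \<in> carrier L" "a \<sqsubseteq> b"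
  shows "upper_star L a \<sqsubseteq> upper_star L b"
proof -
  have "lower_star L (upper_star L a) \<sqsubseteq> a"
    using assms by (simp add: star_galois)
  then have "lower_star L (upper_star L a) \<sqsubseteq> b"
    using assms le_trans[of _ a b] by simp
  then show ?thesis
    using assms by (simp add: star_galois)
qed

lemma lower_star_mono:
  assumes "a \<in> carrier L" "b \<in> carrier L" "a \<sqsubseteq> b"
  shows "lower_star L a \<sqsubseteq> lower_star L b"
proof -
  have "b \<sqsubseteq> upper_star L (lower_star L b)"
    using assms by (simp flip: star_galois)
  then have "a \<sqsubseteq> upper_star L (lower_star L b)"
    using assms le_trans[of a b] by simp
  then show ?thesis
    using assms by (simp add: star_galois)
qed


section \<open>The skeleton\<close>

text \<open>A complemented interval can be enlarged upwards to the upper star of its bottom and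
  downwards to the lower star of its top, so maximality fixes both ends. Conversely, inside a
  complemented interval containing \<open>B\<close>, the two intervals that share one end with
  \<open>B\<close> are complemented, and this leaves no room on either side.\<close>

lemma blocks_iff:
  "B \<in> blocks L \<longleftrightarrow>
    (\<exists>a\<in>carrier L. lower_star L (upper_star L a) = a \<and> B = \<lbrace>a..upper_star L a\<rbrace>)"
  (is "?l \<longleftrightarrow> ?r")
proof
  assume ?l
  then have ci: "complemented_interval L B"
    by (simp add: blocks_def)
  obtain a b where c: "compl L a b" and B: "B = \<lbrace>a..b\<rbrace>"
    using ci unfolding complemented_interval_iff[OF partial_order_axioms] by blast
  then have ab: "a \<in> carrier L" "b \<in> carrier L" "a \<sqsubseteq> b" "b \<sqsubseteq> upper_star L a"
    "lower_star L b \<sqsubseteq> a"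
    using compl_le_upper_star[OF c] compl_iff_lower_star_le[of a b] by (auto simp: compl_def)
  have max: "\<lbrace>c..d\<rbrace> = \<lbrace>a..b\<rbrace>" if "compl L c d" "\<lbrace>a..b\<rbrace> \<subseteq> \<lbrace>c..d\<rbrace>" for c d
    using \<open>?l\<close> that unfolding blocks_def complemented_interval_iff[OF partial_order_axioms] B
    by blast
  have "\<lbrace>a..upper_star L a\<rbrace> = \<lbrace>a..b\<rbrace>"
    using ab by (intro max compl_upper_star interval_mono) auto
  moreover have "upper_star L a \<in> \<lbrace>a..upper_star L a\<rbrace>"
    using ab le_upper_star by (auto simp: mem_interval_iff)
  ultimately have u: "b = upper_star L a"
    using ab le_antisym by (auto simp: mem_interval_iff)
  have "lower_star L b \<sqsubseteq> b"
    using ab le_trans[of _ a b] by simp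
  then have "\<lbrace>lower_star L b..b\<rbrace> = \<lbrace>a..b\<rbrace>"
    using ab by (intro max interval_mono) (auto simp: compl_iff_lower_star_le)
  moreover have "lower_star L b \<in> \<lbrace>lower_star L b..b\<rbrace>"
    using ab \<open>lower_star L b \<sqsubseteq> b\<close> by (auto simp: mem_interval_iff)
  ultimately have "lower_star L b = a"
    using ab le_antisym by (auto simp: mem_interval_iff)
  with u ab B show ?r by blast
next
  assume ?r
  then obtain a where a: "a \<in> carrier L" "lower_star L (upper_star L a) = a"
    and B: "B = \<lbrace>a..upper_star L a\<rbrace>"
    by blast
  have "\<lbrace>c..d\<rbrace> = \<lbrace>a..upper_star L a\<rbrace>"
    if c: "compl L c d" and sub: "\<lbrace>a..upper_star L a\<rbrace> \<subseteq> \<lbrace>c..d\<rbrace>" for c d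
  proof -
    have cd: "c \<in> carrier L" "d \<in> carrier L"
      using c by (auto simp: compl_def)
    have le: "c \<sqsubseteq> a" "upper_star L a \<sqsubseteq> d"
      using sub a le_upper_star[of a] by (auto simp: mem_interval_iff subset_iff)
    have "a \<sqsubseteq> d" "c \<sqsubseteq> upper_star L a"
      using a cd le le_upper_star le_trans by (metis upper_star_closed)+
    \<comment> \<open>One end of the larger interval is kept at a time: the first instance bounds
      \<open>d\<close> by the upper star of \<open>a\<close>, the second bounds \<open>c\<close>
      from below by the lower star of that star, which is \<open>a\<close>.\<close>
    then have "compl L a d" "compl L c (upper_star L a)"
      using a cd le by (auto intro!: compl_subinterval[OF c])
    then have "d \<sqsubseteq> upper_star L a" "a \<sqsubseteq> c"
      using a cd by (auto simp: compl_le_upper_star compl_iff_lower_star_le)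
    with le show ?thesis
      using a cd le_antisym upper_star_closed by metis
  qed
  then show ?l
    unfolding blocks_def complemented_interval_iff[OF partial_order_axioms] B
    using compl_upper_star a by blast
qed

lemma zero_of_block:
  "a \<in> carrier L \<Longrightarrow> zero_of L \<lbrace>a..upper_star L a\<rbrace> = a"
  by (simp add: zero_of_interval le_upper_star)

text \<open>\<open>blk\<close> is an order isomorphism onto the skeleton from the fixed points
  \<open>I\<close> of the interior operator sending \<open>a\<close> to
  \<open>lower_star L (upper_star L a)\<close>. Fixed points are closed under joins, and the
  interior of a meet is their greatest lower bound in \<open>I\<close>.\<close>

lemma skeleton_lattice: "lattice (skeleton L)"
proof -
  define I where "I = {a \<in> carrier L. lower_star L (upper_star L a) = a}"
  define blk where "blk a = \<lbrace>a..upper_star L a\<rbrace>" for a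
  have I: "a \<in> carrier L" "lower_star L (upper_star L a) = a" if "a \<in> I" for a
    using that by (auto simp: I_def)
  have car: "carrier (skeleton L) = blk ` I"
    by (auto simp: skeleton_def blocks_iff I_def blk_def)
  have le: "blk a \<sqsubseteq>\<^bsub>skeleton L\<^esub> blk b \<longleftrightarrow> a \<sqsubseteq> b" if "a \<in> I" "b \<in> I" for a b
    using that by (simp add: skeleton_def blk_def zero_of_block I_def)
  have eq: "eq (skeleton L) = (=)"
    by (simp add: skeleton_def)
  have mono: "lower_star L (upper_star L a) \<sqsubseteq> lower_star L (upper_star L b)"
    if "a \<in> carrier L" "b \<in> carrier L" "a \<sqsubseteq> b" for a b
    using that by (simp add: lower_star_mono upper_star_mono)
  have below: "lower_star L (upper_star L a) \<sqsubseteq> a" if "a \<in> carrier L" for a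
    using that star_galois by simp
  have interior: "lower_star L (upper_star L a) \<in> I" if a: "a \<in> carrier L" for a
  proof -
    \<comment> \<open>The unit of the Galois connection at \<open>upper_star L a\<close>; applying
      \<open>lower_star\<close> to it gives idempotence of the interior operator.\<close>
    have "upper_star L a \<sqsubseteq> upper_star L (lower_star L (upper_star L a))"
      using a star_galois by (metis le_refl lower_star_closed upper_star_closed)
    then have "lower_star L (upper_star L a)
        \<sqsubseteq> lower_star L (upper_star L (lower_star L (upper_star L a)))"
      using a by (simp add: lower_star_mono)
    then show ?thesis
      using a below by (auto simp: I_def intro: le_antisym)
  qed
  have fixI: "a \<in> I" if "a \<in> carrier L" "a \<sqsubseteq> lower_star L (upper_star L a)" for a
    using that below le_antisym by (auto simp: I_def)
  interpret S: partial_order "skeleton L"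
  proof
    fix x y z
    assume "x \<sqsubseteq>\<^bsub>skeleton L\<^esub> y" "y \<sqsubseteq>\<^bsub>skeleton L\<^esub> z"
      "x \<in> carrier (skeleton L)" "y \<in> carrier (skeleton L)" "z \<in> carrier (skeleton L)"
    then show "x \<sqsubseteq>\<^bsub>skeleton L\<^esub> z"
      unfolding car using le I le_trans by (auto; metis)
  next
    fix x y
    assume "x \<sqsubseteq>\<^bsub>skeleton L\<^esub> y" "y \<sqsubseteq>\<^bsub>skeleton L\<^esub> x"
      "x \<in> carrier (skeleton L)" "y \<in> carrier (skeleton L)"
    then show "x .=\<^bsub>skeleton L\<^esub> y"
      unfolding car eq using le I le_antisym by (auto; metis)
  qed (use le I in \<open>auto simp: car eq\<close>)
  show ?thesis
  proof
    fix x y assume "x \<in> carrier (skeleton L)" "y \<in> carrier (skeleton L)"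
    then obtain a b where ab: "a \<in> I" "b \<in> I" "x = blk a" "y = blk b"
      by (auto simp: car)
    have jc: "a \<squnion> b \<in> carrier L"
      using ab I by simp
    have "a \<sqsubseteq> lower_star L (upper_star L (a \<squnion> b))" "b \<sqsubseteq> lower_star L (upper_star L (a \<squnion> b))"
      using ab I mono[of a "a \<squnion> b"] mono[of b "a \<squnion> b"] jc
      by (simp_all add: join_left join_right)
    then have j: "a \<squnion> b \<in> I"
      using ab I jc by (auto intro!: fixI join_le)
    have "is_lub (skeleton L) (blk (a \<squnion> b)) {x, y}"
    proof (rule least_UpperI)
      show "z \<sqsubseteq>\<^bsub>skeleton L\<^esub> blk (a \<squnion> b)" if "z \<in> {x, y}" for z
        using that ab I j by (auto simp: le join_left join_right)
      fix z assume z: "z \<in> Upper (skeleton L) {x, y}"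
      then obtain c where c: "c \<in> I" "z = blk c"
        by (auto simp: Upper_def car)
      then have "a \<sqsubseteq> c" "b \<sqsubseteq> c"
        using z ab by (auto simp: Upper_def car le)
      then show "blk (a \<squnion> b) \<sqsubseteq>\<^bsub>skeleton L\<^esub> z"
        using c ab I j by (simp add: le join_le)
    qed (use ab j in \<open>auto simp: car\<close>)
    then show "\<exists>s. is_lub (skeleton L) s {x, y}" ..
    \<comment> \<open>The meet in \<open>L\<close> need not be a fixed point, so its interior is
      taken. A fixed point \<open>c\<close> below the meet stays below it, since \<open>c\<close> is
      its own interior.\<close>
    let ?m = "lower_star L (upper_star L (a \<sqinter> b))"
    have mc: "a \<sqinter> b \<in> carrier L"
      using ab I by simp
    have m: "?m \<in> I"
      using interior mc by simp
    have "?m \<sqsubseteq> a" "?m \<sqsubseteq> b"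
      using mono[of "a \<sqinter> b" a] mono[of "a \<sqinter> b" b] ab I mc
      by (simp_all add: meet_left meet_right)
    then have below_m: "blk ?m \<sqsubseteq>\<^bsub>skeleton L\<^esub> z" if "z \<in> {x, y}" for z
      using that ab m by (auto simp: le)
    have "is_glb (skeleton L) (blk ?m) {x, y}"
    proof (rule greatest_LowerI[OF below_m])
      fix z assume z: "z \<in> Lower (skeleton L) {x, y}"
      then obtain c where c: "c \<in> I" "z = blk c"
        by (auto simp: Lower_def car)
      then have "c \<sqsubseteq> a" "c \<sqsubseteq> b"
        using z ab by (auto simp: Lower_def car le)
      then have "c \<sqsubseteq> ?m"
        using mono[of c "a \<sqinter> b"] c ab I mc by (simp add: meet_le)
      then show "z \<sqsubseteq>\<^bsub>skeleton L\<^esub> blk ?m"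
        using c m by (simp add: le)
    qed (use ab m in \<open>auto simp: car\<close>)
    then show "\<exists>s. is_glb (skeleton L) s {x, y}" ..
  qed
qed

end


section \<open>Transport along a lattice isomorphism\<close>

lemma lattice_iso_image_interval:
  assumes f: "lattice_iso A B f" and "a \<in> carrier A" "b \<in> carrier A"
  shows "f ` \<lbrace>a..b\<rbrace>\<^bsub>A\<^esub> = \<lbrace>f a..f b\<rbrace>\<^bsub>B\<^esub>"
proof -
  have surj: "f ` carrier A = carrier B"
    using f by (simp add: lattice_iso_def bij_betw_def)
  have mem: "f x \<in> \<lbrace>f a..f b\<rbrace>\<^bsub>B\<^esub> \<longleftrightarrow> x \<in> \<lbrace>a..b\<rbrace>\<^bsub>A\<^esub>" if "x \<in> carrier A" for x
    using assms that surj by (auto simp: mem_interval_iff lattice_iso_le_iff[OF f])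
  show ?thesis
  proof (intro equalityI subsetI)
    fix y assume "y \<in> f ` \<lbrace>a..b\<rbrace>\<^bsub>A\<^esub>"
    then show "y \<in> \<lbrace>f a..f b\<rbrace>\<^bsub>B\<^esub>"
      using mem at_least_at_most_def[of A a b] by auto
  next
    fix y assume y: "y \<in> \<lbrace>f a..f b\<rbrace>\<^bsub>B\<^esub>"
    then have "y \<in> f ` carrier A"
      unfolding surj by (simp add: mem_interval_iff)
    then show "y \<in> f ` \<lbrace>a..b\<rbrace>\<^bsub>A\<^esub>"
      using y mem by auto
  qed
qed

lemma compl_image:
  assumes f: "lattice_iso A B f" and c: "compl A a b"
  shows "compl B (f a) (f b)"
proof -
  have ab: "a \<in> carrier A" "b \<in> carrier A" "a \<sqsubseteq>\<^bsub>A\<^esub> b"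
    using c by (auto simp: compl_def)
  have pres: "f x \<sqinter>\<^bsub>B\<^esub> f y = f (x \<sqinter>\<^bsub>A\<^esub> y)" "f x \<squnion>\<^bsub>B\<^esub> f y = f (x \<squnion>\<^bsub>A\<^esub> y)" "f x \<in> carrier B"
    if "x \<in> carrier A" "y \<in> carrier A" for x y
    using f that by (auto simp: lattice_iso_def join_pres_def meet_pres_def bij_betw_def)
  have "\<exists>y\<in>\<lbrace>f a..f b\<rbrace>\<^bsub>B\<^esub>. x \<sqinter>\<^bsub>B\<^esub> y = f a \<and> x \<squnion>\<^bsub>B\<^esub> y = f b" if "x \<in> \<lbrace>f a..f b\<rbrace>\<^bsub>B\<^esub>" for x
  proof -
    obtain u where u: "u \<in> \<lbrace>a..b\<rbrace>\<^bsub>A\<^esub>" "x = f u"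
      using \<open>x \<in> _\<close> lattice_iso_image_interval[OF f ab(1,2)] by blast
    then obtain v where v: "v \<in> \<lbrace>a..b\<rbrace>\<^bsub>A\<^esub>" "u \<sqinter>\<^bsub>A\<^esub> v = a" "u \<squnion>\<^bsub>A\<^esub> v = b"
      using c by (auto simp: compl_def)
    then have "f v \<in> \<lbrace>f a..f b\<rbrace>\<^bsub>B\<^esub>"
      using lattice_iso_image_interval[OF f ab(1,2)] by blast
    with u v show ?thesis
      using pres by (intro bexI[of _ "f v"]) (auto simp: mem_interval_iff)
  qed
  then show ?thesis
    using ab pres lattice_iso_le_iff[OF f] by (auto simp: compl_def)
qed

section \<open>Images of blocks\<close>

lemma lattice_iso_partial_order:
  assumes "lattice_iso A B f"
  shows "partial_order A" "partial_order B"
  using assms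
  by (auto simp: lattice_iso_def join_pres_def lattice_def upper_semilattice_def)

lemma complemented_interval_image:
  assumes f: "lattice_iso A B f" and C: "complemented_interval A C"
  shows "complemented_interval B (f ` C)"
proof -
  obtain a b where c: "compl A a b" "C = \<lbrace>a..b\<rbrace>\<^bsub>A\<^esub>"
    using C complemented_interval_iff[OF lattice_iso_partial_order(1)[OF f]] by blast
  then have "f ` C = \<lbrace>f a..f b\<rbrace>\<^bsub>B\<^esub>"
    using lattice_iso_image_interval[OF f] by (simp add: compl_def)
  then show ?thesis
    using compl_image[OF f c(1)] complemented_interval_iff[OF lattice_iso_partial_order(2)[OF f]]
    by blast
qed

lemma complemented_interval_closed: "complemented_interval L C \<Longrightarrow> C \<subseteq> carrier L"
  by (auto simp: complemented_interval_def is_interval_def mem_interval_iff)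

lemma block_image:
  assumes f: "lattice_iso A B f" and C: "C \<in> blocks A"
  shows "f ` C \<in> blocks B"
proof -
  let ?g = "inv_into (carrier A) f"
  have bij: "bij_betw f (carrier A) (carrier B)"
    using f by (simp add: lattice_iso_def)
  have ci: "complemented_interval A C"
    using C by (simp add: blocks_def)
  have "D = f ` C" if D: "complemented_interval B D" "f ` C \<subseteq> D" for D
  proof -
    have "?g ` f ` C = C"
      using bij complemented_interval_closed[OF ci] by (simp add: bij_betw_def inv_into_image_cancel)
    then have "C \<subseteq> ?g ` D"
      using image_mono[OF D(2), of ?g] by simp
    moreover have "complemented_interval A (?g ` D)"
      using complemented_interval_image[OF lattice_iso_inv_into[OF f] D(1)] .
    ultimately have "?g ` D = C"
      using C by (auto simp: blocks_def)
    moreover have "f ` ?g ` D = D"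
      using bij complemented_interval_closed[OF D(1)]
      by (simp add: bij_betw_def image_inv_into_cancel)
    ultimately show ?thesis by simp
  qed
  then show ?thesis
    using complemented_interval_image[OF f ci] by (simp add: blocks_def)
qed

lemma blocks_intervalE:
  assumes "C \<in> blocks L"
  obtains a b where "a \<in> carrier L" "b \<in> carrier L" "a \<sqsubseteq>\<^bsub>L\<^esub> b" "C = \<lbrace>a..b\<rbrace>\<^bsub>L\<^esub>"
  using assms by (auto simp: blocks_def complemented_interval_def is_interval_def)

lemma blocks_closed: "C \<in> blocks L \<Longrightarrow> C \<subseteq> carrier L"
  by (simp add: blocks_def complemented_interval_closed)

lemma zero_of_image:
  assumes f: "lattice_iso A B f" and C: "C \<in> blocks A"
  shows "zero_of A C \<in> carrier A" "zero_of B (f ` C) = f (zero_of A C)"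
proof -
  obtain a b where ab: "a \<in> carrier A" "b \<in> carrier A" "a \<sqsubseteq>\<^bsub>A\<^esub> b" "C = \<lbrace>a..b\<rbrace>\<^bsub>A\<^esub>"
    using C by (rule blocks_intervalE)
  have fab: "f a \<in> carrier B" "f b \<in> carrier B" "f a \<sqsubseteq>\<^bsub>B\<^esub> f b"
    using f ab lattice_iso_le_iff[OF f] by (auto simp: lattice_iso_def bij_betw_def)
  have z: "zero_of A C = a"
    using partial_order.zero_of_interval[OF lattice_iso_partial_order(1)[OF f] ab(1-3)] ab(4)
    by simp
  then show "zero_of A C \<in> carrier A"
    using ab by simp
  show "zero_of B (f ` C) = f (zero_of A C)"
    unfolding z
    using partial_order.zero_of_interval[OF lattice_iso_partial_order(2)[OF f] fab]
      lattice_iso_image_interval[OF f ab(1,2)] ab(4) by simp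
qed

lemma lattice_iso_block:
  assumes f: "lattice_iso A B f" and C: "C \<in> blocks A"
  shows "lattice_iso (restrict_order A C) (restrict_order B (f ` C)) f"
proof (rule lattice_isoI)
  have lat: "lattice A" "lattice B"
    using f by (auto simp: lattice_iso_def join_pres_def)
  show "lattice (restrict_order A C)"
    using lattice.interval_lattice[OF lat(1)] blocks_intervalE[OF C] by metis
  show "lattice (restrict_order B (f ` C))"
    using lattice.interval_lattice[OF lat(2)] blocks_intervalE[OF block_image[OF f C]] by metis
  show "bij_betw f (carrier (restrict_order A C)) (carrier (restrict_order B (f ` C)))"
    using f blocks_closed[OF C] by (auto simp: lattice_iso_def bij_betw_def intro: inj_on_subset)
  show "f x \<sqsubseteq>\<^bsub>restrict_order B (f ` C)\<^esub> f y \<longleftrightarrow> x \<sqsubseteq>\<^bsub>restrict_order A C\<^esub> y"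
    if "x \<in> carrier (restrict_order A C)" "y \<in> carrier (restrict_order A C)" for x y
    using that lattice_iso_le_iff[OF f, of x y] blocks_closed[OF C] by auto
qed

lemma bij_betw_blocks:
  assumes f: "lattice_iso A B f"
  shows "bij_betw ((`) f) (blocks A) (blocks B)"
proof -
  let ?g = "inv_into (carrier A) f"
  have bij: "bij_betw f (carrier A) (carrier B)"
    using f by (simp add: lattice_iso_def)
  show ?thesis
  proof (rule bij_betw_byWitness[where f' = "(`) ?g"])
    show "\<forall>C\<in>blocks A. ?g ` f ` C = C"
      using bij blocks_closed by (metis bij_betw_def inv_into_image_cancel)
    show "\<forall>D\<in>blocks B. f ` ?g ` D = D"
      using bij blocks_closed by (metis bij_betw_def image_inv_into_cancel)
    show "(`) f ` blocks A \<subseteq> blocks B" "(`) ?g ` blocks B \<subseteq> blocks A"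
      using block_image[OF f] block_image[OF lattice_iso_inv_into[OF f]] by auto
  qed
qed

theorem theorem5p30:
  fixes L :: "'a gorder" and L' :: "'b gorder"
  assumes "modular_lattice L" and "lffc_lattice L"
    and "modular_lattice L'" and "lffc_lattice L'"
    and "lattice_isomorphic L L'"
  shows "system_isomorphic (dissection L) (dissection L')"
proof -
  obtain f where f: "lattice_iso L L' f"
    using assms(5) by (auto simp: lattice_isomorphic_def)
  have inj: "inj_on f (carrier L)"
    using f by (simp add: lattice_iso_def bij_betw_def)
  have "lattice_iso (skeleton L) (skeleton L') ((`) f)"
  proof (rule lattice_isoI)
    show "lattice (skeleton L)" "lattice (skeleton L')"
      using assms by (simp_all add: modular_lffc_lattice.intro modular_lffc_lattice.skeleton_lattice)
    show "bij_betw ((`) f) (carrier (skeleton L)) (carrier (skeleton L'))"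
      using bij_betw_blocks[OF f] by (simp add: skeleton_def)
    show "f ` B \<sqsubseteq>\<^bsub>skeleton L'\<^esub> f ` C \<longleftrightarrow> B \<sqsubseteq>\<^bsub>skeleton L\<^esub> C"
      if "B \<in> carrier (skeleton L)" "C \<in> carrier (skeleton L)" for B C
      using that zero_of_image[OF f] lattice_iso_le_iff[OF f] by (simp add: skeleton_def)
  qed
  \<comment> \<open>Injectivity lets images commute with intersections. This one equation settles
    the tolerance and both ends of every connection, all of which are given by
    \<open>B \<inter> C\<close>.\<close>
  moreover have "f ` B \<inter> f ` C = f ` (B \<inter> C)" if "B \<in> blocks L" "C \<in> blocks L" for B C
    using inj_on_image_Int[OF inj] that blocks_closed by metis
  \<comment> \<open>Every block map is \<open>f\<close> itself, read on the block in question. The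
    connections are identities, so they commute with these maps trivially.\<close>
  ultimately have "system_iso (dissection L) (dissection L') ((`) f) (\<lambda>_. f)"
    using lattice_iso_block[OF f]
    by (simp add: system_iso_def dissection_def tol_le_def) (simp add: skeleton_def)
  then show ?thesis
    by (auto simp: system_isomorphic_def)
qed

end
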